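(* Let $n\in\{1,\dots,N\}$, let $M\ge1$ be an integer, $m\in\{1,2,\dots,M\}$, $h>0$ and $d\ge0$. Then for all $t_1,t_2$ with $0\le t_1\le t_2\le\tau$, $$Q_{n,m}(d,h;M,t_1)\ \ge\ Q_{n,m}(d,h;M,t_2).$$
   Context: Constants: $N\ge1$ is an integer (number of sub-tasks); $W>0$ (bandwidth); $\tau>0$ (channel coherence time). $p$ is a probability density on $(0,\infty)$, the common density of the i.i.d. channel gains. Energy to send $d\ge0$ nats in a fading block of duration $s>0$ with channel gain $h>0$: $e(d,h,s)=\dfrac{\left(e^{d/(Ws)}-1\right)s}{h}$. For $s=0$ set, by the limit $s\to0^+$, $e(0,h,0)=0$ and $e(d,h,0)=+\infty$ for $d>0$. For an integer $M\ge1$ (number of fading blocks) and $t\in[0,\tau]$ (duration of the last block; the first $M-1$ blocks have duration $\tau$), the functions $Q_{n,m}(d,h;M,t)$ and $Q_{n,m}(d;M,t)$, for $m\in\{1,\dots,M\}$, $d\ge0$, $h>0$, are defined by backward recursion on $m$: $$Q_{n,M}(d,h;M,t)=e(d,h,t),$$ $$Q_{n,m}(d;M,t)=\int_0^\infty Q_{n,m}(d,x;M,t)\,p(x)\,dx\qquad (1\le m\le M),$$ $$Q_{n,m}(d,h;M,t)=\min_{0\le d'\le d}\Big(e(d',h,\tau)+Q_{n,m+1}(d-d';M,t)\Big)\qquad (1\le m\le M-1).$$ Values are taken in $[0,+\infty]$, and the minimum is read as an infimum if it is not attained. With these conventions, $Q_{n,m}(d,h;M,0)=Q_{n,m}(d,h;M-1,\tau)$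 for $1\le m\le M-1$. *)

theory Defs
  imports "HOL-Analysis.Analysis"
begin

definition density_on_pos :: "(real \<Rightarrow> real) \<Rightarrow> bool" where
  "density_on_pos p \<longleftrightarrow>
     set_borel_measurable lborel {0<..} p \<and>
     (\<forall>x>0. 0 \<le> p x) \<and>
     (\<integral>\<^sup>+x\<in>{0<..}. ennreal (p x) \<partial>lborel) = 1"

definition energy :: "real \<Rightarrow> real \<Rightarrow> real \<Rightarrow> real \<Rightarrow> ennreal" where
  "energy W d h s =
     (if s = 0 then (if d = 0 then 0 else \<infinity>)
      else ennreal ((exp (d / (W * s)) - 1) * s / h))"

text \<open>
  \<open>Q W \<tau> p n m d h M t\<close> is \<open>Q\<^sub>n\<^sub>,\<^sub>m(d, h; M, t)\<close> and \<open>Q_avg W \<tau> p n m d M t\<close> is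
  \<open>Q\<^sub>n\<^sub>,\<^sub>m(d; M, t)\<close>. The sub-task index \<open>n\<close> does not enter the recursion. Only
  \<open>1 \<le> m \<le> M\<close> is meaningful; for \<open>m > M\<close> the value is a dummy one.
\<close>

function Q :: "real \<Rightarrow> real \<Rightarrow> (real \<Rightarrow> real) \<Rightarrow> nat \<Rightarrow> nat \<Rightarrow> real \<Rightarrow> real \<Rightarrow> nat \<Rightarrow> real \<Rightarrow> ennreal"
  and Q_avg :: "real \<Rightarrow> real \<Rightarrow> (real \<Rightarrow> real) \<Rightarrow> nat \<Rightarrow> nat \<Rightarrow> real \<Rightarrow> nat \<Rightarrow> real \<Rightarrow> ennreal"
where
  "Q W \<tau> p n m d h M t =
     (if m < M
      then (INF d'\<in>{0..d}. energy W d' h \<tau> + Q_avg W \<tau> p n (m + 1) (d - d') M t)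
      else energy W d h t)"
| "Q_avg W \<tau> p n m d M t =
     (\<integral>\<^sup>+x\<in>{0<..}. Q W \<tau> p n m d x M t * ennreal (p x) \<partial>lborel)"
  by pat_completeness auto
termination
  by (relation "Wellfounded.measure (case_sum
        (\<lambda>(W, \<tau>, p, n, m, d, h, M, t). 2 * (M - m))
        (\<lambda>(W, \<tau>, p, n, m, d, M, t). 2 * (M - m) + 1))") auto

declare Q.simps [simp del] Q_avg.simps [simp del]

end

theory Submission
  imports Defs
begin

text \<open>
  Convexity of the exponential makes the energy antitone in the block duration. The duration
  \<open>t\<close> enters the recursion only through its innermost energy term, and infima and integrals
  against a nonnegative weight are monotone.
\<close>

text \<open>With \<open>r = s1 / s2\<close>, the point \<open>a / s2\<close> is the convex
  combination of 0 and \<open>a / s1\<close> with weights \<open>1 - r\<close> and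
  \<open>r\<close>.\<close>

lemma scaled_exp_minus_one_antimono:
  fixes a s1 s2 :: real
  assumes "0 < s1" "s1 \<le> s2"
  shows "(exp (a / s2) - 1) * s2 \<le> (exp (a / s1) - 1) * s1"
proof -
  define r where "r = s1 / s2"
  have r: "0 \<le> r" "r \<le> 1" using assms by (auto simp: r_def)
  have "exp ((1 - r) *\<^sub>R 0 + r *\<^sub>R (a / s1)) \<le> (1 - r) * exp 0 + r * exp (a / s1)"
    using r by (intro convex_onD[OF exp_convex]) auto
  also have "(1 - r) *\<^sub>R 0 + r *\<^sub>R (a / s1) = a / s2"
    using assms by (simp add: r_def)
  finally have "exp (a / s2) - 1 \<le> r * (exp (a / s1) - 1)"
    by (simp add: algebra_simps)
  then have "(exp (a / s2) - 1) * s2 \<le> r * (exp (a / s1) - 1) * s2"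
    using assms by (intro mult_right_mono) auto
  also have "\<dots> = (exp (a / s1) - 1) * s1"
    using assms by (simp add: r_def)
  finally show ?thesis .
qed

lemma energy_antimono:
  assumes "h > 0" "0 \<le> s1" "s1 \<le> s2"
  shows "energy W d h s2 \<le> energy W d h s1"
proof (cases "s1 = 0")
  case True
  then show ?thesis by (simp add: energy_def)
next
  case False
  then have "(exp (d / W / s2) - 1) * s2 \<le> (exp (d / W / s1) - 1) * s1"
    using assms by (intro scaled_exp_minus_one_antimono) auto
  then show ?thesis
    using False assms by (auto simp: energy_def intro!: ennreal_leI divide_right_mono)
qed

lemma Q_antimono:
  assumes "0 \<le> t1" "t1 \<le> t2" "h > 0"
  shows "Q W \<tau> p n m d h M t2 \<le> Q W \<tau> p n m d h M t1"
  using \<open>h > 0\<close>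
proof (induction "M - m" arbitrary: m d h)
  \<comment> \<open>Truncated subtraction puts every \<open>m\<close> \<ge> \<open>M\<close> here,
    where \<open>Q\<close> is the energy with duration \<open>t\<close>.\<close>
  case 0
  then show ?case
    using assms by (simp add: Q.simps energy_antimono)
next
  case (Suc k)
  have avg: "Q_avg W \<tau> p n (m + 1) d' M t2 \<le> Q_avg W \<tau> p n (m + 1) d' M t1" for d'
    unfolding Q_avg.simps
  proof (intro nn_integral_mono)
    fix x :: real
    show "Q W \<tau> p n (m + 1) d' x M t2 * ennreal (p x) * indicator {0<..} x
        \<le> Q W \<tau> p n (m + 1) d' x M t1 * ennreal (p x) * indicator {0<..} x"
    \<comment> \<open>The induction hypothesis requires a positive gain; elsewhere the indicator
      makes both sides 0.\<close>
    proof (cases "x > 0")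
      case True
      with Suc have "Q W \<tau> p n (m + 1) d' x M t2 \<le> Q W \<tau> p n (m + 1) d' x M t1"
        by simp
      then show ?thesis by (intro mult_right_mono) auto
    qed simp
  qed
  have "m < M" using Suc by simp
  then show ?case
    \<comment> \<open>For each \<open>d'\<close> the first summand has duration
      \<open>\<tau>\<close> on both sides, so \<open>avg\<close> compares the rest.\<close>
    by (subst (1 2) Q.simps) (auto intro!: INF_mono' add_left_mono avg[simplified])
qed

theorem lemma1:
  fixes W \<tau> :: real and p :: "real \<Rightarrow> real" and N n M m :: nat and d h t1 t2 :: real
  assumes "N \<ge> 1" and "W > 0" and "\<tau> > 0" and "density_on_pos p"
    and "n \<in> {1..N}" and "M \<ge> 1" and "m \<in> {1..M}" and "h > 0" and "d \<ge> 0"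
    and "0 \<le> t1" and "t1 \<le> t2" and "t2 \<le> \<tau>"
  shows "Q W \<tau> p n m d h M t1 \<ge> Q W \<tau> p n m d h M t2"
  using assms by (intro Q_antimono)

end
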